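(* Let $\mathbf A$ be a non-trivial algebra of type $\{\land,\lor,\otimes,\oplus,\neg\}$ and $F\subseteq A$. Then the matrix $\langle\mathbf A,F\rangle$ is a reduced model of $\mathcal{LB}$ if and only if $\mathbf A$ is a distributive bilattice isomorphic to $\mathbf{Reg}(\mathbf A)\odot\mathbf{Reg}(\mathbf A)$ such that the following conditions are satisfied: (i) $\mathbf{Reg}(\mathbf A)=\langle \mathrm{Reg}(\mathbf A),\otimes,\oplus\rangle$ is a distributive lattice with top element $\top$ satisfying the property that, for all $a,b\in\mathrm{Reg}(\mathbf A)$ such that $a<_k b$, there is $c\in\mathrm{Reg}(\mathbf A)$ such that $a\oplus c\neq\top$ and $b\oplus c=\top$; (ii) $F=\mathcal{FF}(\top)$, the bifilter of $\mathbf A$ generated by $\top$.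
   Context: A bilattice is an algebra $\langle B,\land,\lor,\otimes,\oplus,\neg\rangle$ such that $\langle B,\land,\lor\rangle$ and $\langle B,\otimes,\oplus\rangle$ are lattices (not necessarily bounded) with associated orders $\leq_t$ and $\leq_k$, and $\neg$ is a unary operation such that for all $a,b$: $a\leq_t b$ implies $\neg b\leq_t\neg a$; $a\leq_k b$ implies $\neg a\leq_k\neg b$; $\neg\neg a=a$. It is distributive if $x\circ(y\bullet z)\approx(x\circ y)\bullet(x\circ z)$ holds for all distinct $\circ,\bullet\in\{\land,\lor,\otimes,\oplus\}$. $\mathrm{Reg}(\mathbf B)=\{a\in B: a=\neg a\}$ is the set of regular elements; it is closed under $\otimes,\oplus$ by the De Morgan laws. A bifilter is a non-empty subset that is a lattice filter with respect to both $\leq_t$ and $\leq_k$; $\mathcal{FF}(\top)$ is the least bifilter containing $\top$. For a lattice $\mathbf L=\langle L,\sqcap,\sqcup\rangle$, the product bilattice $\mathbf L\odot\mathbf L$ has universe $L\times L$ and operations $\langle a_1,a_2\rangle\land\langle b_1,b_2\rangle=\langle a_1\sqcap b_1,a_2\sqcup b_2\rangle$, $\langle a_1,a_2\rangle\lor\langle b_1,b_2\rangle=\langle a_1\sqcup b_1,a_2\sqcap b_2\rangle$, $\langle a_1,a_2\rangle\otimes\langle b_1,b_2\rangle=\langle a_1\sqcap b_1,a_2\sqcap b_2\rangle$, $\langle a_1,a_2\rangle\oplus\langle b_1,b_2\rangle=\langle a_1\sqcup b_1,a_2\sqcup b_2\rangle$, $\neg\langle a_1,a_2\rangle=\langle a_2,a_1\rangle$.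 $\mathcal{FOUR}$ is the bilattice with universe $\{\mathsf f,\bot,\top,\mathsf t\}$ with $\mathsf f <_t \bot,\top <_t \mathsf t$ ($\bot,\top$ $\leq_t$-incomparable), $\bot <_k \mathsf f,\mathsf t <_k \top$ ($\mathsf f,\mathsf t$ $\leq_k$-incomparable), and $\neg \mathsf f = \mathsf t$, $\neg\mathsf t=\mathsf f$, $\neg\bot=\bot$, $\neg\top=\top$. Let $\mathsf{Tr}=\{\top,\mathsf t\}$. $\mathbf{Fm}$ is the formula algebra over a countable set of variables in the language $\{\land,\lor,\otimes,\oplus,\neg\}$, and $\mathcal{LB}$ is the logic given by: $\Gamma\models_{\mathcal{LB}}\varphi$ iff for every homomorphism $h:\mathbf{Fm}\to\mathcal{FOUR}$, $h[\Gamma]\subseteq \mathsf{Tr}$ implies $h(\varphi)\in\mathsf{Tr}$. A matrix $\langle\mathbf A,F\rangle$ ($F\subseteq A$) is a model of $\mathcal{LB}$ if whenever $\Gamma\models_{\mathcal{LB}}\varphi$ and $h:\mathbf{Fm}\to\mathbf A$ is a homomorphism with $h[\Gamma]\subseteq F$, then $h(\varphi)\in F$. It is reduced if the greatest congruence $\theta$ of $\mathbf A$ compatible with $F$ (i.e. $a\in F$, $\langle a,b\rangle\in\theta$ imply $b\in F$) is the identity. *)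

theory Defs
  imports Main
begin

text \<open>The four binary operation symbols are reified, so that conditions on distinct operations
  speak about distinct symbols and not about distinct functions.\<close>

datatype binop = And | Or | Otimes | Oplus

record 'a alg =
  univ :: "'a set"
  bop :: "binop \<Rightarrow> 'a \<Rightarrow> 'a \<Rightarrow> 'a"
  neg :: "'a \<Rightarrow> 'a"

definition algebra :: "'a alg \<Rightarrow> bool" where
  "algebra A \<longleftrightarrow>
     univ A \<noteq> {} \<and>
     (\<forall>s. \<forall>a\<in>univ A. \<forall>b\<in>univ A. bop A s a b \<in> univ A) \<and>
     (\<forall>a\<in>univ A. neg A a \<in> univ A)"

definition nontrivial :: "'a alg \<Rightarrow> bool" where
  "nontrivial A \<longleftrightarrow> (\<exists>a\<in>univ A. \<exists>b\<in>univ A. a \<noteq> b)"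

definition is_hom :: "'a alg \<Rightarrow> 'b alg \<Rightarrow> ('a \<Rightarrow> 'b) \<Rightarrow> bool" where
  "is_hom A B h \<longleftrightarrow>
     (\<forall>a\<in>univ A. h a \<in> univ B) \<and>
     (\<forall>s. \<forall>a\<in>univ A. \<forall>b\<in>univ A. h (bop A s a b) = bop B s (h a) (h b)) \<and>
     (\<forall>a\<in>univ A. h (neg A a) = neg B (h a))"

definition isomorphic :: "'a alg \<Rightarrow> 'b alg \<Rightarrow> bool" where
  "isomorphic A B \<longleftrightarrow> (\<exists>h. is_hom A B h \<and> bij_betw h (univ A) (univ B))"

definition congruence :: "'a alg \<Rightarrow> ('a \<times> 'a) set \<Rightarrow> bool" where
  "congruence A \<theta> \<longleftrightarrow>
     equiv (univ A) \<theta> \<and>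
     (\<forall>s a a' b b'. (a, a') \<in> \<theta> \<and> (b, b') \<in> \<theta> \<longrightarrow> (bop A s a b, bop A s a' b') \<in> \<theta>) \<and>
     (\<forall>a a'. (a, a') \<in> \<theta> \<longrightarrow> (neg A a, neg A a') \<in> \<theta>)"

record 'a lat =
  lat_univ :: "'a set"
  lat_meet :: "'a \<Rightarrow> 'a \<Rightarrow> 'a"
  lat_join :: "'a \<Rightarrow> 'a \<Rightarrow> 'a"

text \<open>Idempotence follows from absorption.\<close>

definition is_lattice :: "'a lat \<Rightarrow> bool" where
  "is_lattice L \<longleftrightarrow>
     lat_univ L \<noteq> {} \<and>
     (\<forall>a\<in>lat_univ L. \<forall>b\<in>lat_univ L. lat_meet L a b \<in> lat_univ L \<and> lat_join L a b \<in> lat_univ L) \<and>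
     (\<forall>a\<in>lat_univ L. \<forall>b\<in>lat_univ L.
        lat_meet L a b = lat_meet L b a \<and> lat_join L a b = lat_join L b a) \<and>
     (\<forall>a\<in>lat_univ L. \<forall>b\<in>lat_univ L. \<forall>c\<in>lat_univ L.
        lat_meet L (lat_meet L a b) c = lat_meet L a (lat_meet L b c) \<and>
        lat_join L (lat_join L a b) c = lat_join L a (lat_join L b c)) \<and>
     (\<forall>a\<in>lat_univ L. \<forall>b\<in>lat_univ L.
        lat_meet L a (lat_join L a b) = a \<and> lat_join L a (lat_meet L a b) = a)"

definition is_distrib_lattice :: "'a lat \<Rightarrow> bool" where
  "is_distrib_lattice L \<longleftrightarrow>
     is_lattice L \<and>
     (\<forall>a\<in>lat_univ L. \<forall>b\<in>lat_univ L. \<forall>c\<in>lat_univ L.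
        lat_meet L a (lat_join L b c) = lat_join L (lat_meet L a b) (lat_meet L a c))"

definition lat_le :: "'a lat \<Rightarrow> 'a \<Rightarrow> 'a \<Rightarrow> bool" where
  "lat_le L a b \<longleftrightarrow> lat_meet L a b = a"

definition lat_less :: "'a lat \<Rightarrow> 'a \<Rightarrow> 'a \<Rightarrow> bool" where
  "lat_less L a b \<longleftrightarrow> lat_le L a b \<and> a \<noteq> b"

definition is_top :: "'a lat \<Rightarrow> 'a \<Rightarrow> bool" where
  "is_top L u \<longleftrightarrow> u \<in> lat_univ L \<and> (\<forall>a\<in>lat_univ L. lat_le L a u)"

definition lat_filter :: "'a lat \<Rightarrow> 'a set \<Rightarrow> bool" where
  "lat_filter L F \<longleftrightarrow>
     F \<subseteq> lat_univ L \<and> F \<noteq> {} \<and>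
     (\<forall>a\<in>F. \<forall>b\<in>F. lat_meet L a b \<in> F) \<and>
     (\<forall>a\<in>F. \<forall>b\<in>lat_univ L. lat_le L a b \<longrightarrow> b \<in> F)"

definition t_reduct :: "'a alg \<Rightarrow> 'a lat" where
  "t_reduct A = \<lparr>lat_univ = univ A, lat_meet = bop A And, lat_join = bop A Or\<rparr>"

definition k_reduct :: "'a alg \<Rightarrow> 'a lat" where
  "k_reduct A = \<lparr>lat_univ = univ A, lat_meet = bop A Otimes, lat_join = bop A Oplus\<rparr>"

abbreviation le_t :: "'a alg \<Rightarrow> 'a \<Rightarrow> 'a \<Rightarrow> bool" where
  "le_t A \<equiv> lat_le (t_reduct A)"

abbreviation le_k :: "'a alg \<Rightarrow> 'a \<Rightarrow> 'a \<Rightarrow> bool" where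
  "le_k A \<equiv> lat_le (k_reduct A)"

definition bilattice :: "'a alg \<Rightarrow> bool" where
  "bilattice A \<longleftrightarrow>
     algebra A \<and> is_lattice (t_reduct A) \<and> is_lattice (k_reduct A) \<and>
     (\<forall>a\<in>univ A. \<forall>b\<in>univ A. le_t A a b \<longrightarrow> le_t A (neg A b) (neg A a)) \<and>
     (\<forall>a\<in>univ A. \<forall>b\<in>univ A. le_k A a b \<longrightarrow> le_k A (neg A a) (neg A b)) \<and>
     (\<forall>a\<in>univ A. neg A (neg A a) = a)"

definition distrib_bilattice :: "'a alg \<Rightarrow> bool" where
  "distrib_bilattice A \<longleftrightarrow>
     bilattice A \<and>
     (\<forall>s r. s \<noteq> r \<longrightarrow>
        (\<forall>x\<in>univ A. \<forall>y\<in>univ A. \<forall>z\<in>univ A.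
           bop A s x (bop A r y z) = bop A r (bop A s x y) (bop A s x z)))"

definition Reg :: "'a alg \<Rightarrow> 'a lat" where
  "Reg A = \<lparr>lat_univ = {a \<in> univ A. a = neg A a}, lat_meet = bop A Otimes, lat_join = bop A Oplus\<rparr>"

definition bifilter :: "'a alg \<Rightarrow> 'a set \<Rightarrow> bool" where
  "bifilter A F \<longleftrightarrow> lat_filter (t_reduct A) F \<and> lat_filter (k_reduct A) F"

definition FF :: "'a alg \<Rightarrow> 'a \<Rightarrow> 'a set" where
  "FF A a = \<Inter>{G. bifilter A G \<and> a \<in> G}"

fun prod_bop :: "'a lat \<Rightarrow> binop \<Rightarrow> 'a \<times> 'a \<Rightarrow> 'a \<times> 'a \<Rightarrow> 'a \<times> 'a" where
  "prod_bop L And (a1, a2) (b1, b2) = (lat_meet L a1 b1, lat_join L a2 b2)"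
| "prod_bop L Or (a1, a2) (b1, b2) = (lat_join L a1 b1, lat_meet L a2 b2)"
| "prod_bop L Otimes (a1, a2) (b1, b2) = (lat_meet L a1 b1, lat_meet L a2 b2)"
| "prod_bop L Oplus (a1, a2) (b1, b2) = (lat_join L a1 b1, lat_join L a2 b2)"

definition prod_bilattice :: "'a lat \<Rightarrow> ('a \<times> 'a) alg" where
  "prod_bilattice L =
     \<lparr>univ = lat_univ L \<times> lat_univ L, bop = prod_bop L, neg = (\<lambda>(a1, a2). (a2, a1))\<rparr>"

datatype four = Ff | Bt | Tp | Tt

definition four_le_t :: "four \<Rightarrow> four \<Rightarrow> bool" where
  "four_le_t x y \<longleftrightarrow> x = y \<or> x = Ff \<or> y = Tt"

definition four_le_k :: "four \<Rightarrow> four \<Rightarrow> bool" where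
  "four_le_k x y \<longleftrightarrow> x = y \<or> x = Bt \<or> y = Tp"

text \<open>Meets and joins of comparable elements are given by the order; the only incomparable
  elements are the two intermediate ones, whose meet and join are the extreme elements.\<close>

fun four_bop :: "binop \<Rightarrow> four \<Rightarrow> four \<Rightarrow> four" where
  "four_bop And x y = (if four_le_t x y then x else if four_le_t y x then y else Ff)"
| "four_bop Or x y = (if four_le_t x y then y else if four_le_t y x then x else Tt)"
| "four_bop Otimes x y = (if four_le_k x y then x else if four_le_k y x then y else Bt)"
| "four_bop Oplus x y = (if four_le_k x y then y else if four_le_k y x then x else Tp)"

fun four_neg :: "four \<Rightarrow> four" where
  "four_neg Ff = Tt"
| "four_neg Tt = Ff"
| "four_neg Bt = Bt"
| "four_neg Tp = Tp"

definition FOUR :: "four alg" where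
  "FOUR = \<lparr>univ = UNIV, bop = four_bop, neg = four_neg\<rparr>"

definition Tr :: "four set" where
  "Tr = {Tp, Tt}"

lemma FOUR_le: "le_t FOUR = four_le_t" "le_k FOUR = four_le_k"
proof -
  have "le_t FOUR x y = four_le_t x y" "le_k FOUR x y = four_le_k x y" for x y
    by (cases x; cases y;
        simp add: FOUR_def lat_le_def t_reduct_def k_reduct_def four_le_t_def four_le_k_def)+
  then show "le_t FOUR = four_le_t" "le_k FOUR = four_le_k" by blast+
qed

lemma FOUR_distrib_bilattice: "distrib_bilattice FOUR"
proof -
  have lat: "is_lattice (t_reduct FOUR)" "is_lattice (k_reduct FOUR)"
    unfolding is_lattice_def t_reduct_def k_reduct_def FOUR_def
    by (auto simp: four_le_t_def four_le_k_def)
  have neg: "four_le_t x y \<Longrightarrow> four_le_t (four_neg y) (four_neg x)"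
    "four_le_k x y \<Longrightarrow> four_le_k (four_neg x) (four_neg y)" "four_neg (four_neg x) = x" for x y
    by (cases x; cases y; simp add: four_le_t_def four_le_k_def)+
  have dist: "four_bop s x (four_bop r y z) = four_bop r (four_bop s x y) (four_bop s x z)"
    for s r x y z
    by (cases s; cases r; cases x; cases y; cases z; simp add: four_le_t_def four_le_k_def)
  show ?thesis
    using lat neg dist
    unfolding distrib_bilattice_def bilattice_def algebra_def FOUR_le
    by (simp add: FOUR_def)
qed

datatype fm = Var nat | Bin binop fm fm | Neg fm

definition Fm :: "fm alg" where
  "Fm = \<lparr>univ = UNIV, bop = Bin, neg = Neg\<rparr>"

definition LB_entails :: "fm set \<Rightarrow> fm \<Rightarrow> bool" where
  "LB_entails \<Gamma> \<phi> \<longleftrightarrow> (\<forall>h. is_hom Fm FOUR h \<longrightarrow> h ` \<Gamma> \<subseteq> Tr \<longrightarrow> h \<phi> \<in> Tr)"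

definition LB_model :: "'a alg \<Rightarrow> 'a set \<Rightarrow> bool" where
  "LB_model A F \<longleftrightarrow>
     (\<forall>\<Gamma> \<phi> h. LB_entails \<Gamma> \<phi> \<longrightarrow> is_hom Fm A h \<longrightarrow> h ` \<Gamma> \<subseteq> F \<longrightarrow> h \<phi> \<in> F)"

definition compatible :: "('a \<times> 'a) set \<Rightarrow> 'a set \<Rightarrow> bool" where
  "compatible \<theta> F \<longleftrightarrow> (\<forall>a b. a \<in> F \<and> (a, b) \<in> \<theta> \<longrightarrow> b \<in> F)"

definition is_greatest_compatible_congruence :: "'a alg \<Rightarrow> 'a set \<Rightarrow> ('a \<times> 'a) set \<Rightarrow> bool" where
  "is_greatest_compatible_congruence A F \<theta> \<longleftrightarrow>
     congruence A \<theta> \<and> compatible \<theta> F \<and>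
     (\<forall>\<eta>. congruence A \<eta> \<and> compatible \<eta> F \<longrightarrow> \<eta> \<subseteq> \<theta>)"

definition reduced :: "'a alg \<Rightarrow> 'a set \<Rightarrow> bool" where
  "reduced A F \<longleftrightarrow> is_greatest_compatible_congruence A F (Id_on (univ A))"

end

theory Submission
  imports Defs
begin

text \<open>
  A prime filter \<open>P\<close> of a lattice \<open>L\<close> gives a homomorphism \<open>(x, y) \<mapsto> (x \<in> P, y \<in> P)\<close> from \<open>L \<odot> L\<close>
  to \<open>FOUR\<close>, so by the prime filter theorem \<open>L \<odot> L\<close> satisfies the identities of \<open>FOUR\<close> when \<open>L\<close> is
  distributive. In a reduced model the relation \<open>\<forall>c. (a \<or> c \<in> F \<longleftrightarrow> b \<or> c \<in> F) \<and> (\<not> a \<or> c \<in> F \<longleftrightarrow> \<not> b \<or> c \<in> F)\<close>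
  is a compatible congruence, hence equality, so the identities of \<open>FOUR\<close> hold there too.
  They provide a term \<open>r\<close> acting as \<open>(x, y) \<mapsto> (x, x)\<close>, for which \<open>a \<mapsto> (r a, r (\<not> a))\<close> is an
  isomorphism onto \<open>Reg A \<odot> Reg A\<close> and \<open>{a. r a = \<top>}\<close> is the bifilter generated by \<open>\<top>\<close>.
  For regular \<open>a\<close>, membership of \<open>a \<or> c\<close> in it means \<open>a \<oplus> r c = \<top>\<close>, so condition (i) says that
  distinct regular elements are told apart by the congruence above.
\<close>

section \<open>Prime filters of distributive lattices\<close>

locale carrier_lattice =
  fixes L :: "'a lat"
  assumes lattice: "is_lattice L"
begin

abbreviation meet_L (infixl "\<sqinter>" 70) where "x \<sqinter> y \<equiv> lat_meet L x y"
abbreviation join_L (infixl "\<squnion>" 65) where "x \<squnion> y \<equiv> lat_join L x y"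
abbreviation le_L (infix "\<sqsubseteq>" 50) where "x \<sqsubseteq> y \<equiv> lat_le L x y"
abbreviation "C \<equiv> lat_univ L"

lemma closed [simp]: "a \<in> C \<Longrightarrow> b \<in> C \<Longrightarrow> a \<sqinter> b \<in> C" "a \<in> C \<Longrightarrow> b \<in> C \<Longrightarrow> a \<squnion> b \<in> C"
  using lattice by (auto simp: is_lattice_def)

lemma comm: "a \<in> C \<Longrightarrow> b \<in> C \<Longrightarrow> a \<sqinter> b = b \<sqinter> a" "a \<in> C \<Longrightarrow> b \<in> C \<Longrightarrow> a \<squnion> b = b \<squnion> a"
  using lattice by (simp_all add: is_lattice_def)

lemma assoc:
  assumes "a \<in> C" "b \<in> C" "c \<in> C"
  shows "a \<sqinter> b \<sqinter> c = a \<sqinter> (b \<sqinter> c)" "a \<squnion> b \<squnion> c = a \<squnion> (b \<squnion> c)"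
proof -
  have "\<forall>a\<in>C. \<forall>b\<in>C. \<forall>c\<in>C. a \<sqinter> b \<sqinter> c = a \<sqinter> (b \<sqinter> c) \<and> a \<squnion> b \<squnion> c = a \<squnion> (b \<squnion> c)"
    using lattice unfolding is_lattice_def by (elim conjE)
  then show "a \<sqinter> b \<sqinter> c = a \<sqinter> (b \<sqinter> c)" "a \<squnion> b \<squnion> c = a \<squnion> (b \<squnion> c)"
    using assms by blast+
qed

lemma absorb: "a \<in> C \<Longrightarrow> b \<in> C \<Longrightarrow> a \<sqinter> (a \<squnion> b) = a" "a \<in> C \<Longrightarrow> b \<in> C \<Longrightarrow> a \<squnion> a \<sqinter> b = a"
  using lattice by (simp_all add: is_lattice_def)

lemma idem: "a \<in> C \<Longrightarrow> a \<sqinter> a = a"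
  using absorb(1)[of a "a \<sqinter> a"] absorb(2)[of a a] by simp

lemma le_refl: "a \<in> C \<Longrightarrow> a \<sqsubseteq> a"
  by (simp add: lat_le_def idem)

lemma le_trans: "a \<in> C \<Longrightarrow> b \<in> C \<Longrightarrow> c \<in> C \<Longrightarrow> a \<sqsubseteq> b \<Longrightarrow> b \<sqsubseteq> c \<Longrightarrow> a \<sqsubseteq> c"
  using assoc(1)[of a b c] by (simp add: lat_le_def)

lemma le_antisym: "a \<in> C \<Longrightarrow> b \<in> C \<Longrightarrow> a \<sqsubseteq> b \<Longrightarrow> b \<sqsubseteq> a \<Longrightarrow> a = b"
  using comm(1)[of a b] by (simp add: lat_le_def)

lemma le_iff_join: "a \<in> C \<Longrightarrow> b \<in> C \<Longrightarrow> a \<sqsubseteq> b \<longleftrightarrow> a \<squnion> b = b"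
  using absorb(1)[of a b] absorb(2)[of b a] comm[of a b] comm(2)[of b "b \<sqinter> a"]
  by (auto simp: lat_le_def)

lemma meet_le: "a \<in> C \<Longrightarrow> b \<in> C \<Longrightarrow> a \<sqinter> b \<sqsubseteq> a" "a \<in> C \<Longrightarrow> b \<in> C \<Longrightarrow> a \<sqinter> b \<sqsubseteq> b"
  using assoc(1)[of a b a] assoc(1)[of a a b] assoc(1)[of a b b] comm(1)[of b a] idem[of a] idem[of b]
  by (simp_all add: lat_le_def)

lemma le_join: "a \<in> C \<Longrightarrow> b \<in> C \<Longrightarrow> a \<sqsubseteq> a \<squnion> b" "a \<in> C \<Longrightarrow> b \<in> C \<Longrightarrow> b \<sqsubseteq> a \<squnion> b"
  using absorb(1)[of a b] absorb(1)[of b a] comm(2)[of b a] by (simp_all add: lat_le_def)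

lemma le_meetI: "a \<in> C \<Longrightarrow> b \<in> C \<Longrightarrow> c \<in> C \<Longrightarrow> c \<sqsubseteq> a \<Longrightarrow> c \<sqsubseteq> b \<Longrightarrow> c \<sqsubseteq> a \<sqinter> b"
  using assoc(1)[of c a b] by (simp add: lat_le_def)

lemma join_leI:
  assumes "a \<in> C" "b \<in> C" "c \<in> C" "a \<sqsubseteq> c" "b \<sqsubseteq> c"
  shows "a \<squnion> b \<sqsubseteq> c"
  using assms by (simp add: le_iff_join assoc)

lemma meet_mono:
  assumes "a \<in> C" "b \<in> C" "c \<in> C" "a \<sqsubseteq> b"
  shows "a \<sqinter> c \<sqsubseteq> b \<sqinter> c"
  using assms le_trans[of "a \<sqinter> c" a b] by (simp add: le_meetI meet_le)

end

definition prime_set :: "'a lat \<Rightarrow> 'a set \<Rightarrow> bool" where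
  "prime_set L P \<longleftrightarrow>
     (\<forall>a\<in>lat_univ L. \<forall>b\<in>lat_univ L.
        (lat_meet L a b \<in> P \<longleftrightarrow> a \<in> P \<and> b \<in> P) \<and> (lat_join L a b \<in> P \<longleftrightarrow> a \<in> P \<or> b \<in> P))"

text \<open>Zorn's lemma supplies a filter that is maximal among those containing \<open>x\<close>
  and omitting \<open>y\<close>; distributivity makes it prime.\<close>

lemma prime_filter_separation:
  assumes D: "is_distrib_lattice L" and x: "x \<in> lat_univ L" and y: "y \<in> lat_univ L"
    and nle: "\<not> lat_le L x y"
  obtains P where "prime_set L P" "x \<in> P" "y \<notin> P"
proof -
  interpret carrier_lattice L
    using D by unfold_locales (simp add: is_distrib_lattice_def)
  let ?S = "{G. lat_filter L G \<and> x \<in> G \<and> y \<notin> G}"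
  have "lat_filter L {z \<in> C. x \<sqsubseteq> z}"
    unfolding lat_filter_def using x by (auto intro: le_refl le_meetI) (meson le_trans)
  then have "?S \<noteq> {}"
    using x nle le_refl by blast
  moreover have "\<Union>K \<in> ?S" if "K \<noteq> {}" "subset.chain ?S K" for K
  proof -
    have K: "K \<subseteq> ?S" and chain: "\<And>G H. G \<in> K \<Longrightarrow> H \<in> K \<Longrightarrow> G \<subseteq> H \<or> H \<subseteq> G"
      using that(2) by (auto simp: subset_chain_def)
    have filter: "lat_filter L G" if "G \<in> K" for G
      using K that by blast
    have "a \<sqinter> b \<in> \<Union>K" if ab: "a \<in> \<Union>K" "b \<in> \<Union>K" for a b
    proof -
      obtain G H where "G \<in> K" "a \<in> G" "H \<in> K" "b \<in> H" using ab by blast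
      then obtain M where "M \<in> K" "a \<in> M" "b \<in> M" using chain by blast
      then show ?thesis using filter unfolding lat_filter_def by blast
    qed
    moreover have "\<Union>K \<subseteq> C" "\<forall>a\<in>\<Union>K. \<forall>b\<in>C. a \<sqsubseteq> b \<longrightarrow> b \<in> \<Union>K"
      using filter unfolding lat_filter_def by blast+
    moreover have "x \<in> \<Union>K" "y \<notin> \<Union>K"
      using K that(1) by blast+
    ultimately show ?thesis
      unfolding lat_filter_def by blast
  qed
  ultimately obtain G where G: "G \<in> ?S" and max: "\<And>H. H \<in> ?S \<Longrightarrow> G \<subseteq> H \<Longrightarrow> H = G"
    using subset_Zorn_nonempty[of ?S] by (metis (no_types, lifting))
  have sub: "G \<subseteq> C" and meet: "\<And>a b. a \<in> G \<Longrightarrow> b \<in> G \<Longrightarrow> a \<sqinter> b \<in> G"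
    and up: "\<And>a b. a \<in> G \<Longrightarrow> b \<in> C \<Longrightarrow> a \<sqsubseteq> b \<Longrightarrow> b \<in> G" and xG: "x \<in> G" and yG: "y \<notin> G"
    using G by (auto simp: lat_filter_def)
  \<comment> \<open>The filter generated by \<open>G\<close> and \<open>a\<close> properly extends
    \<open>G\<close>, so maximality forces \<open>y\<close> into it.\<close>
  have ext: "\<exists>g\<in>G. g \<sqinter> a \<sqsubseteq> y" if a: "a \<in> C" "a \<notin> G" for a
  proof (rule ccontr)
    assume no: "\<not> ?thesis"
    let ?H = "{z \<in> C. \<exists>g\<in>G. g \<sqinter> a \<sqsubseteq> z}"
    have GH: "G \<subseteq> ?H"
      using sub a meet_le(1) by blast
    have "p \<sqinter> q \<in> ?H" if pq: "p \<in> ?H" "q \<in> ?H" for p q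
    proof -
      obtain g h where g: "g \<in> G" "h \<in> G" "g \<sqinter> a \<sqsubseteq> p" "h \<sqinter> a \<sqsubseteq> q" "p \<in> C" "q \<in> C"
        using pq by blast
      then have c: "g \<in> C" "h \<in> C" using sub by auto
      have "g \<sqinter> h \<sqinter> a \<sqsubseteq> g \<sqinter> a" "g \<sqinter> h \<sqinter> a \<sqsubseteq> h \<sqinter> a"
        using c a(1) by (auto intro: meet_mono meet_le)
      then have "g \<sqinter> h \<sqinter> a \<sqsubseteq> p" "g \<sqinter> h \<sqinter> a \<sqsubseteq> q"
        using g c a(1) le_trans[of "g \<sqinter> h \<sqinter> a" "g \<sqinter> a" p]
          le_trans[of "g \<sqinter> h \<sqinter> a" "h \<sqinter> a" q] by simp_all
      then have "g \<sqinter> h \<sqinter> a \<sqsubseteq> p \<sqinter> q"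
        using g c a(1) by (simp add: le_meetI)
      then show ?thesis
        using g meet by auto
    qed
    moreover have "q \<in> ?H" if pq: "p \<in> ?H" "q \<in> C" "p \<sqsubseteq> q" for p q
    proof -
      obtain g where g: "g \<in> G" "g \<sqinter> a \<sqsubseteq> p" "p \<in> C"
        using pq by blast
      then have "g \<sqinter> a \<sqsubseteq> q"
        using sub a(1) pq le_trans[of "g \<sqinter> a" p q] by auto
      then show ?thesis
        using g pq by blast
    qed
    moreover have "?H \<subseteq> C" "?H \<noteq> {}"
      using GH xG by auto
    ultimately have "lat_filter L ?H"
      unfolding lat_filter_def by (intro conjI ballI impI)
    then have "?H = G"
      using max[of ?H] GH xG no by blast
    moreover have "a \<in> ?H"
      using a x xG meet_le(2) by blast
    ultimately show False
      using a by blast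
  qed
  have prime: "a \<in> G \<or> b \<in> G" if ab: "a \<in> C" "b \<in> C" "a \<squnion> b \<in> G" for a b
  proof (rule ccontr)
    assume "\<not> ?thesis"
    then obtain g h where g: "g \<in> G" "h \<in> G" "g \<sqinter> a \<sqsubseteq> y" "h \<sqinter> b \<sqsubseteq> y"
      using ext ab by blast
    then have c: "g \<in> C" "h \<in> C" using sub by auto
    \<comment> \<open>A common lower bound of both witnesses in \<open>G\<close>: distributivity
      then puts its meet with \<open>a \<squnion> b\<close>, an element of \<open>G\<close>, below
      \<open>y\<close>.\<close>
    let ?k = "g \<sqinter> h"
    have "?k \<sqinter> a \<sqsubseteq> g \<sqinter> a" "?k \<sqinter> b \<sqsubseteq> h \<sqinter> b"
      using c ab by (auto intro: meet_mono meet_le)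
    then have "?k \<sqinter> a \<sqsubseteq> y" "?k \<sqinter> b \<sqsubseteq> y"
      using g c ab y le_trans[of "?k \<sqinter> a" "g \<sqinter> a" y] le_trans[of "?k \<sqinter> b" "h \<sqinter> b" y] by simp_all
    then have "?k \<sqinter> a \<squnion> ?k \<sqinter> b \<sqsubseteq> y"
      using c ab y by (simp add: join_leI)
    moreover have "?k \<sqinter> (a \<squnion> b) = ?k \<sqinter> a \<squnion> ?k \<sqinter> b"
      using D c ab by (simp add: is_distrib_lattice_def)
    ultimately show False
      using up[OF meet[OF meet[OF g(1,2)] ab(3)] y] yG by simp
  qed
  have "prime_set L G"
    unfolding prime_set_def
  proof (intro ballI conjI iffI)
    fix a b assume ab: "a \<in> C" "b \<in> C"
    show "a \<in> G" "b \<in> G" if "a \<sqinter> b \<in> G"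
      using up[OF that] ab meet_le by blast+
    show "a \<squnion> b \<in> G" if "a \<in> G \<or> b \<in> G"
      using that up[OF _ closed(2)[OF ab]] le_join[OF ab] by auto
  qed (auto intro: meet dest: prime)
  then show ?thesis
    using that xG yG by blast
qed

section \<open>Homomorphisms into the four-element bilattice\<close>

lemma Fm_simps [simp]: "univ Fm = UNIV" "bop Fm = Bin" "neg Fm = Neg"
  by (simp_all add: Fm_def)

lemma is_hom_comp: "is_hom A B f \<Longrightarrow> is_hom B D g \<Longrightarrow> is_hom A D (\<lambda>x. g (f x))"
  by (simp add: is_hom_def)

text \<open>A value is coded by two bits, whether it is designated and whether its negation is.
  Equations in \<open>FOUR\<close> thus become propositional statements, resolved by
  \<open>four_bop_Tr\<close>.\<close>

lemma four_eq_iff: "x = y \<longleftrightarrow> (x \<in> Tr \<longleftrightarrow> y \<in> Tr) \<and> (four_neg x \<in> Tr \<longleftrightarrow> four_neg y \<in> Tr)"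
  by (cases x; cases y; simp add: Tr_def)

lemma four_bop_Tr:
  "four_bop And x y \<in> Tr \<longleftrightarrow> x \<in> Tr \<and> y \<in> Tr"
  "four_bop Otimes x y \<in> Tr \<longleftrightarrow> x \<in> Tr \<and> y \<in> Tr"
  "four_bop Or x y \<in> Tr \<longleftrightarrow> x \<in> Tr \<or> y \<in> Tr"
  "four_bop Oplus x y \<in> Tr \<longleftrightarrow> x \<in> Tr \<or> y \<in> Tr"
  "four_neg (four_bop And x y) \<in> Tr \<longleftrightarrow> four_neg x \<in> Tr \<or> four_neg y \<in> Tr"
  "four_neg (four_bop Otimes x y) \<in> Tr \<longleftrightarrow> four_neg x \<in> Tr \<and> four_neg y \<in> Tr"
  "four_neg (four_bop Or x y) \<in> Tr \<longleftrightarrow> four_neg x \<in> Tr \<and> four_neg y \<in> Tr"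
  "four_neg (four_bop Oplus x y) \<in> Tr \<longleftrightarrow> four_neg x \<in> Tr \<or> four_neg y \<in> Tr"
  "four_neg (four_neg x) = x"
  by (cases x; cases y; simp add: Tr_def four_le_t_def four_le_k_def)+

declare four_bop.simps [simp del]

lemma hom_FOUR:
  assumes "is_hom Fm FOUR h"
  shows "h (Bin s \<phi> \<psi>) = four_bop s (h \<phi>) (h \<psi>)" "h (Neg \<phi>) = four_neg (h \<phi>)"
  using assms by (simp_all add: is_hom_def FOUR_def)

lemmas hom_FOUR_Tr = hom_FOUR four_bop_Tr

text \<open>Identifies \<open>FOUR\<close> with the product bilattice of the two-element
  lattice.\<close>

definition four_of :: "bool \<Rightarrow> bool \<Rightarrow> four" where
  "four_of p q = (if p then if q then Tp else Tt else if q then Ff else Bt)"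

lemma four_of_Tr [simp]: "four_of p q \<in> Tr \<longleftrightarrow> p" "four_neg (four_of p q) \<in> Tr \<longleftrightarrow> q"
  by (simp_all add: four_of_def Tr_def)

lemma prime_set_hom:
  assumes P: "prime_set L P"
  shows "is_hom (prod_bilattice L) FOUR (\<lambda>(x, y). four_of (x \<in> P) (y \<in> P))"
proof -
  have "four_of (fst (prod_bop L s (a, b) (c, d)) \<in> P) (snd (prod_bop L s (a, b) (c, d)) \<in> P) =
      four_bop s (four_of (a \<in> P) (b \<in> P)) (four_of (c \<in> P) (d \<in> P))"
    if "a \<in> lat_univ L" "b \<in> lat_univ L" "c \<in> lat_univ L" "d \<in> lat_univ L" for s a b c d
    using P that by (cases s) (simp_all add: four_eq_iff four_bop_Tr prime_set_def)
  moreover have "four_neg (four_of p q) = four_of q p" for p q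
    by (simp add: four_of_def)
  ultimately show ?thesis
    by (simp add: is_hom_def prod_bilattice_def FOUR_def case_prod_beta)
qed

section \<open>Evaluation of formulas under assignments\<close>

primrec ev :: "'a alg \<Rightarrow> (nat \<Rightarrow> 'a) \<Rightarrow> fm \<Rightarrow> 'a" where
  "ev A v (Var n) = v n"
| "ev A v (Bin s \<phi> \<psi>) = bop A s (ev A v \<phi>) (ev A v \<psi>)"
| "ev A v (Neg \<phi>) = neg A (ev A v \<phi>)"

lemma ev_in_univ: "algebra A \<Longrightarrow> (\<And>n. v n \<in> univ A) \<Longrightarrow> ev A v \<phi> \<in> univ A"
  by (induction \<phi>) (simp_all add: algebra_def)

lemma ev_hom: "algebra A \<Longrightarrow> (\<And>n. v n \<in> univ A) \<Longrightarrow> is_hom Fm A (ev A v)"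
  by (simp add: is_hom_def ev_in_univ)

lemma hom_eq_ev:
  assumes "is_hom Fm A g"
  shows "g = ev A (\<lambda>n. g (Var n))"
proof
  show "g \<phi> = ev A (\<lambda>n. g (Var n)) \<phi>" for \<phi>
    using assms by (induction \<phi>) (simp_all add: is_hom_def)
qed

text \<open>Three values suffice for the identities verified one by one; the last is also the value
  of all further variables, which keeps the assignment inside the carrier.\<close>

definition assign :: "'a \<Rightarrow> 'a \<Rightarrow> 'a \<Rightarrow> nat \<Rightarrow> 'a" where
  "assign a b c n = (if n = 0 then a else if n = 1 then b else c)"

lemma ev_assign_hom:
  "algebra A \<Longrightarrow> a \<in> univ A \<Longrightarrow> b \<in> univ A \<Longrightarrow> c \<in> univ A \<Longrightarrow> is_hom Fm A (ev A (assign a b c))"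
  by (rule ev_hom) (simp_all add: assign_def)

section \<open>Algebras satisfying the identities of the four-element bilattice\<close>

text \<open>In a product bilattice this is \<open>(x, y) \<mapsto> (x, x)\<close>.\<close>

definition reg_part :: "'a alg \<Rightarrow> 'a \<Rightarrow> 'a" where
  "reg_part A a =
     (let b = bop A Or a (bop A Otimes a (neg A a)) in bop A Oplus b (neg A b))"

text \<open>\<open>reg_part\<close> is a term operation: its instance in \<open>Fm\<close> is a
  formula, so identities about it transfer like those of the basic operations.\<close>

lemma ev_reg_part: "ev A v (reg_part Fm \<phi>) = reg_part A (ev A v \<phi>)"
  by (simp add: reg_part_def Let_def)

text \<open>On bits \<open>(p, q)\<close> the inner \<open>Otimes\<close> gives
  \<open>(p \<and> q, p \<and> q)\<close>, the \<open>Or\<close> gives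
  \<open>(p, p \<and> q)\<close>, and the final \<open>Oplus\<close> with the negation gives
  \<open>(p, p)\<close>.\<close>

lemma hom_FOUR_reg_part:
  assumes "is_hom Fm FOUR h"
  shows "h (reg_part Fm \<phi>) \<in> Tr \<longleftrightarrow> h \<phi> \<in> Tr"
    "four_neg (h (reg_part Fm \<phi>)) \<in> Tr \<longleftrightarrow> h \<phi> \<in> Tr"
  using assms by (auto simp: reg_part_def Let_def hom_FOUR_Tr)

text \<open>Membership in the variety generated by \<open>FOUR\<close>. Both directions of the
  theorem pass through this locale, one entering it from reduced models, the other from product
  bilattices.\<close>

locale four_variety =
  fixes A :: "'a alg"
  assumes algebra: "algebra A"
    and identity: "(\<And>h. is_hom Fm FOUR h \<Longrightarrow> h \<phi> = h \<psi>) \<Longrightarrow> is_hom Fm A g \<Longrightarrow> g \<phi> = g \<psi>"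
begin

abbreviation andA (infixl "\<^bold>\<and>" 70) where "a \<^bold>\<and> b \<equiv> bop A And a b"
abbreviation orA (infixl "\<^bold>\<or>" 65) where "a \<^bold>\<or> b \<equiv> bop A Or a b"
abbreviation otimesA (infixl "\<otimes>" 70) where "a \<otimes> b \<equiv> bop A Otimes a b"
abbreviation oplusA (infixl "\<oplus>" 65) where "a \<oplus> b \<equiv> bop A Oplus a b"
abbreviation negA ("\<^bold>\<not> _" [80] 80) where "\<^bold>\<not> a \<equiv> neg A a"
abbreviation r where "r \<equiv> reg_part A"
abbreviation "U \<equiv> univ A"
abbreviation "R \<equiv> lat_univ (Reg A)"

lemma closed [simp]: "a \<in> U \<Longrightarrow> b \<in> U \<Longrightarrow> bop A s a b \<in> U" "a \<in> U \<Longrightarrow> \<^bold>\<not> a \<in> U"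
  using algebra by (auto simp: algebra_def)

lemma closed_reg_part [simp]: "a \<in> U \<Longrightarrow> r a \<in> U"
  by (simp add: reg_part_def Let_def)

lemma identity3:
  assumes "a \<in> U" "b \<in> U" "c \<in> U"
    and "\<And>h. is_hom Fm FOUR h \<Longrightarrow> (h \<phi> \<in> Tr \<longleftrightarrow> h \<psi> \<in> Tr) \<and>
      (four_neg (h \<phi>) \<in> Tr \<longleftrightarrow> four_neg (h \<psi>) \<in> Tr)"
  shows "ev A (assign a b c) \<phi> = ev A (assign a b c) \<psi>"
  using assms by (intro identity ev_assign_hom algebra) (auto simp: four_eq_iff[of "h \<phi>" for h])

lemmas id_simps = ev_reg_part assign_def hom_FOUR_reg_part hom_FOUR_Tr

section \<open>Identities inherited from \<open>FOUR\<close>\<close>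

lemma comm: "a \<in> U \<Longrightarrow> b \<in> U \<Longrightarrow> bop A s a b = bop A s b a"
  using identity3[of a b b "Bin s (Var 0) (Var 1)" "Bin s (Var 1) (Var 0)"]
  by (cases s) (auto simp: id_simps)

lemma assoc: "a \<in> U \<Longrightarrow> b \<in> U \<Longrightarrow> c \<in> U \<Longrightarrow> bop A s (bop A s a b) c = bop A s a (bop A s b c)"
  using identity3[of a b c "Bin s (Bin s (Var 0) (Var 1)) (Var 2)"
      "Bin s (Var 0) (Bin s (Var 1) (Var 2))"]
  by (cases s) (auto simp: id_simps)

lemma idem: "a \<in> U \<Longrightarrow> bop A s a a = a"
  using identity3[of a a a "Bin s (Var 0) (Var 0)" "Var 0"]
  by (cases s) (auto simp: id_simps)

lemma absorb:
  assumes "a \<in> U" "b \<in> U"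
  shows "a \<^bold>\<and> (a \<^bold>\<or> b) = a" "a \<^bold>\<or> a \<^bold>\<and> b = a" "a \<otimes> (a \<oplus> b) = a" "a \<oplus> a \<otimes> b = a"
  using identity3[of a b b "Bin And (Var 0) (Bin Or (Var 0) (Var 1))" "Var 0"]
    identity3[of a b b "Bin Or (Var 0) (Bin And (Var 0) (Var 1))" "Var 0"]
    identity3[of a b b "Bin Otimes (Var 0) (Bin Oplus (Var 0) (Var 1))" "Var 0"]
    identity3[of a b b "Bin Oplus (Var 0) (Bin Otimes (Var 0) (Var 1))" "Var 0"] assms
  by (auto simp: id_simps)

lemma distrib:
  assumes "s \<noteq> s'" "a \<in> U" "b \<in> U" "c \<in> U"
  shows "bop A s a (bop A s' b c) = bop A s' (bop A s a b) (bop A s a c)"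
  using identity3[of a b c "Bin s (Var 0) (Bin s' (Var 1) (Var 2))"
      "Bin s' (Bin s (Var 0) (Var 1)) (Bin s (Var 0) (Var 2))"] assms
  by (cases s; cases s'; auto simp: id_simps)

lemma neg_neg: "a \<in> U \<Longrightarrow> \<^bold>\<not> \<^bold>\<not> a = a"
  using identity3[of a a a "Neg (Neg (Var 0))" "Var 0"] by (auto simp: id_simps)

lemma neg_bop:
  assumes "a \<in> U" "b \<in> U"
  shows "\<^bold>\<not> (a \<^bold>\<and> b) = \<^bold>\<not> a \<^bold>\<or> \<^bold>\<not> b" "\<^bold>\<not> (a \<^bold>\<or> b) = \<^bold>\<not> a \<^bold>\<and> \<^bold>\<not> b"
    "\<^bold>\<not> (a \<otimes> b) = \<^bold>\<not> a \<otimes> \<^bold>\<not> b" "\<^bold>\<not> (a \<oplus> b) = \<^bold>\<not> a \<oplus> \<^bold>\<not> b"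
  using identity3[of a b b "Neg (Bin And (Var 0) (Var 1))" "Bin Or (Neg (Var 0)) (Neg (Var 1))"]
    identity3[of a b b "Neg (Bin Or (Var 0) (Var 1))" "Bin And (Neg (Var 0)) (Neg (Var 1))"]
    identity3[of a b b "Neg (Bin Otimes (Var 0) (Var 1))" "Bin Otimes (Neg (Var 0)) (Neg (Var 1))"]
    identity3[of a b b "Neg (Bin Oplus (Var 0) (Var 1))" "Bin Oplus (Neg (Var 0)) (Neg (Var 1))"]
    assms
  by (auto simp: id_simps)

lemma reg_part_bop:
  assumes "a \<in> U" "b \<in> U"
  shows "r (a \<^bold>\<and> b) = r a \<otimes> r b" "r (a \<otimes> b) = r a \<otimes> r b"
    "r (a \<^bold>\<or> b) = r a \<oplus> r b" "r (a \<oplus> b) = r a \<oplus> r b"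
  using identity3[of a b b "reg_part Fm (Bin And (Var 0) (Var 1))"
      "Bin Otimes (reg_part Fm (Var 0)) (reg_part Fm (Var 1))"]
    identity3[of a b b "reg_part Fm (Bin Otimes (Var 0) (Var 1))"
      "Bin Otimes (reg_part Fm (Var 0)) (reg_part Fm (Var 1))"]
    identity3[of a b b "reg_part Fm (Bin Or (Var 0) (Var 1))"
      "Bin Oplus (reg_part Fm (Var 0)) (reg_part Fm (Var 1))"]
    identity3[of a b b "reg_part Fm (Bin Oplus (Var 0) (Var 1))"
      "Bin Oplus (reg_part Fm (Var 0)) (reg_part Fm (Var 1))"] assms
  by (auto simp: id_simps)

lemma neg_reg_part: "a \<in> U \<Longrightarrow> \<^bold>\<not> r a = r a"
  using identity3[of a a a "Neg (reg_part Fm (Var 0))" "reg_part Fm (Var 0)"]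
  by (auto simp: id_simps)

text \<open>For regular \<open>p\<close> and \<open>q\<close> the two summands have coordinates
  \<open>(p, p \<otimes> q)\<close> and \<open>(p \<otimes> q, q)\<close>, so their sum has
  coordinates \<open>(p, q)\<close>. This inverts the splitting of an element into the regular parts
  of itself and its negation.\<close>

definition pair :: "'a \<Rightarrow> 'a \<Rightarrow> 'a" where
  "pair p q = (p \<^bold>\<or> p \<otimes> q) \<oplus> q \<^bold>\<and> (p \<otimes> q)"

lemma pair_closed [simp]: "p \<in> U \<Longrightarrow> q \<in> U \<Longrightarrow> pair p q \<in> U"
  by (simp add: pair_def)

lemma pair_reg_part: "a \<in> U \<Longrightarrow> pair (r a) (r (\<^bold>\<not> a)) = a"
  using identity3[of a a a "Bin Oplus
      (Bin Or (reg_part Fm (Var 0)) (Bin Otimes (reg_part Fm (Var 0)) (reg_part Fm (Neg (Var 0)))))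
      (Bin And (reg_part Fm (Neg (Var 0)))
        (Bin Otimes (reg_part Fm (Var 0)) (reg_part Fm (Neg (Var 0)))))" "Var 0"]
  by (auto simp: id_simps pair_def)

lemma reg_part_pair:
  assumes "a \<in> U" "b \<in> U"
  shows "r (pair (r a) (r b)) = r a" "r (\<^bold>\<not> pair (r a) (r b)) = r b"
proof -
  let ?p = "Bin Oplus
      (Bin Or (reg_part Fm (Var 0)) (Bin Otimes (reg_part Fm (Var 0)) (reg_part Fm (Var 1))))
      (Bin And (reg_part Fm (Var 1)) (Bin Otimes (reg_part Fm (Var 0)) (reg_part Fm (Var 1))))"
  show "r (pair (r a) (r b)) = r a" "r (\<^bold>\<not> pair (r a) (r b)) = r b"
    using identity3[of a b b "reg_part Fm ?p" "reg_part Fm (Var 0)"]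
      identity3[of a b b "reg_part Fm (Neg ?p)" "reg_part Fm (Var 1)"] assms
    by (auto simp: id_simps pair_def)
qed

text \<open>The element on the right is above \<open>r a\<close> in the truth order and, by this
  identity, below \<open>a\<close> in the knowledge order. It is the stepping stone from
  \<open>r a\<close> to \<open>a\<close> inside a bifilter.\<close>

lemma reg_part_bound: "a \<in> U \<Longrightarrow> (r a \<^bold>\<or> r a \<otimes> a) \<otimes> a = r a \<^bold>\<or> r a \<otimes> a"
  using identity3[of a a a
      "Bin Otimes (Bin Or (reg_part Fm (Var 0)) (Bin Otimes (reg_part Fm (Var 0)) (Var 0))) (Var 0)"
      "Bin Or (reg_part Fm (Var 0)) (Bin Otimes (reg_part Fm (Var 0)) (Var 0))"]
  by (auto simp: id_simps)

section \<open>Regular elements, the product representation and the matrix of the top\<close>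

lemma Reg_simps [simp]:
  "lat_meet (Reg A) = bop A Otimes" "lat_join (Reg A) = bop A Oplus"
  by (simp_all add: Reg_def)

lemma in_Reg_iff: "a \<in> R \<longleftrightarrow> a \<in> U \<and> \<^bold>\<not> a = a"
  by (auto simp: Reg_def)

lemma reg_part_Reg: "a \<in> R \<Longrightarrow> r a = a"
  by (simp add: in_Reg_iff reg_part_def Let_def idem neg_bop)

lemma reg_part_in_Reg [simp]: "a \<in> U \<Longrightarrow> r a \<in> R"
  by (simp add: in_Reg_iff neg_reg_part)

lemma Reg_closed: "a \<in> R \<Longrightarrow> b \<in> R \<Longrightarrow> a \<otimes> b \<in> R" "a \<in> R \<Longrightarrow> b \<in> R \<Longrightarrow> a \<oplus> b \<in> R"
  by (simp_all add: in_Reg_iff neg_bop)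

lemma distrib_lattice_Reg: "is_distrib_lattice (Reg A)"
proof -
  have "R \<noteq> {}"
    using algebra reg_part_in_Reg unfolding algebra_def by blast
  then show ?thesis
    unfolding is_distrib_lattice_def is_lattice_def
    by (auto simp: Reg_closed,
        auto simp: in_Reg_iff assoc absorb distrib[of Otimes Oplus] intro: comm)
qed

lemma bilattice: "distrib_bilattice A"
proof -
  have U: "U \<noteq> {}"
    using algebra by (simp add: algebra_def)
  have "is_lattice (t_reduct A)" "is_lattice (k_reduct A)"
    using U unfolding is_lattice_def t_reduct_def k_reduct_def
    by (auto simp: assoc absorb intro: comm)
  moreover have "le_t A (\<^bold>\<not> b) (\<^bold>\<not> a)" if "a \<in> U" "b \<in> U" "le_t A a b" for a b
    using that absorb(1)[of "\<^bold>\<not> b" "\<^bold>\<not> a"] neg_bop(1)[of a b] comm[of "\<^bold>\<not> b" "\<^bold>\<not> a" Or]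
    by (simp add: lat_le_def t_reduct_def)
  moreover have "le_k A (\<^bold>\<not> a) (\<^bold>\<not> b)" if "a \<in> U" "b \<in> U" "le_k A a b" for a b
    using that neg_bop(3)[of a b] by (simp add: lat_le_def k_reduct_def)
  ultimately show ?thesis
    unfolding distrib_bilattice_def bilattice_def
    using algebra neg_neg by (auto intro: distrib)
qed

lemma reg_parts_hom: "is_hom A (prod_bilattice (Reg A)) (\<lambda>a. (r a, r (\<^bold>\<not> a)))"
proof -
  have "(r (bop A s a b), r (\<^bold>\<not> bop A s a b)) =
      prod_bop (Reg A) s (r a, r (\<^bold>\<not> a)) (r b, r (\<^bold>\<not> b))" if "a \<in> U" "b \<in> U" for s a b
    using that by (cases s) (simp_all add: reg_part_bop neg_bop)
  then show ?thesis
    by (simp add: is_hom_def prod_bilattice_def neg_neg)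
qed

lemma isomorphic_Reg: "isomorphic A (prod_bilattice (Reg A))"
proof -
  have "bij_betw (\<lambda>a. (r a, r (\<^bold>\<not> a))) U (R \<times> R)"
    by (rule bij_betw_byWitness[where f' = "\<lambda>(p, q). pair p q"])
      (auto simp: pair_reg_part in_Reg_iff neg_reg_part, (metis in_Reg_iff reg_part_Reg reg_part_pair)+)
  then show ?thesis
    unfolding isomorphic_def using reg_parts_hom by (auto simp: prod_bilattice_def)
qed

text \<open>The set on the right is a bifilter because \<open>r\<close> sends both meets to
  \<open>Otimes\<close> and \<open>u\<close> is the top. It is the least one because
  \<open>reg_part_bound\<close> leads from \<open>r a = u\<close> up to \<open>a\<close>.\<close>

lemma FF_top:
  assumes u: "is_top (Reg A) u"
  shows "FF A u = {a \<in> U. r a = u}"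
proof
  have uR: "u \<in> R" and top: "\<And>p. p \<in> R \<Longrightarrow> p \<otimes> u = p"
    using u by (auto simp: is_top_def lat_le_def)
  then have uU: "u \<in> U" by (simp add: in_Reg_iff)
  have above: "p = u" if "p \<in> R" "u \<otimes> p = u" for p
    using that top[of p] uU comm[of p u Otimes] by (simp add: in_Reg_iff)
  have up: "r b = u" if "a \<in> U" "r a = u" "b \<in> U" "bop A s a b = a" "s \<in> {And, Otimes}" for a b s
  proof (rule above)
    have "u \<otimes> r b = r (bop A s a b)"
      using that(2,5) reg_part_bop(1,2)[OF that(1,3)] by auto
    then show "u \<otimes> r b = u"
      using that by simp
  qed (use that in simp)
  have "\<exists>a\<in>U. r a = u"
    using uU reg_part_Reg[OF uR] by blast
  then have "bifilter A {a \<in> U. r a = u}"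
    unfolding bifilter_def lat_filter_def t_reduct_def k_reduct_def lat_le_def
    using uU by (auto simp: reg_part_bop idem dest: up)
  then show "FF A u \<subseteq> {a \<in> U. r a = u}"
    unfolding FF_def using uU reg_part_Reg[OF uR] by blast
  show "{a \<in> U. r a = u} \<subseteq> FF A u"
  proof
    fix a assume "a \<in> {a \<in> U. r a = u}"
    then have a: "a \<in> U" "r a = u" by auto
    have "a \<in> G" if G: "bifilter A G" "u \<in> G" for G
    proof -
      have "(\<forall>p\<in>G. \<forall>q\<in>U. p \<^bold>\<and> q = p \<longrightarrow> q \<in> G) \<and> (\<forall>p\<in>G. \<forall>q\<in>U. p \<otimes> q = p \<longrightarrow> q \<in> G)"
        using G(1)
        unfolding bifilter_def lat_filter_def t_reduct_def k_reduct_def lat_le_def lat.simps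
        by (elim conjE) (intro conjI)
      then have up: "q \<in> G" if "p \<in> G" "q \<in> U" "p \<^bold>\<and> q = p \<or> p \<otimes> q = p" for p q
        using that by blast
      \<comment> \<open>Here \<open>u\<close> is rewritten to \<open>r a\<close>, and absorption
        gives the climb in the truth order; the climb in the knowledge order follows.\<close>
      have "r a \<^bold>\<or> r a \<otimes> a \<in> G"
        using a(1) by (intro up[OF G(2)]) (simp_all add: absorb(1) flip: a(2))
      then show ?thesis
        by (rule up) (simp_all add: a(1) reg_part_bound)
    qed
    then show "a \<in> FF A u" unfolding FF_def by blast
  qed
qed

text \<open>If the conclusion fell outside, a prime filter containing \<open>u\<close> but not its
  regular part would yield a countermodel in \<open>FOUR\<close>. One prime filter designates all
  premises at once, as each has regular part \<open>u\<close>, so infinite sets of premises are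
  covered.\<close>

lemma LB_model_FF:
  assumes u: "is_top (Reg A) u"
  shows "LB_model A (FF A u)"
  unfolding LB_model_def
proof (intro allI impI)
  fix \<Gamma> \<phi> g assume ent: "LB_entails \<Gamma> \<phi>" and g: "is_hom Fm A g" and sub: "g ` \<Gamma> \<subseteq> FF A u"
  have gU: "g \<psi> \<in> U" for \<psi>
    using g by (simp add: is_hom_def)
  have uR: "u \<in> R" using u by (simp add: is_top_def)
  show "g \<phi> \<in> FF A u"
  proof (rule ccontr)
    assume "g \<phi> \<notin> FF A u"
    then have "r (g \<phi>) \<noteq> u"
      using gU by (simp add: FF_top[OF u])
    moreover have "r (g \<phi>) \<otimes> u = r (g \<phi>)"
      using u gU by (simp add: is_top_def lat_le_def)
    ultimately have "\<not> lat_le (Reg A) u (r (g \<phi>))"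
      using comm[of u "r (g \<phi>)" Otimes] uR gU by (simp add: lat_le_def in_Reg_iff)
    then obtain P where P: "prime_set (Reg A) P" "u \<in> P" "r (g \<phi>) \<notin> P"
      using prime_filter_separation[OF distrib_lattice_Reg uR] gU by (metis reg_part_in_Reg)
    let ?h = "\<lambda>\<psi>. four_of (r (g \<psi>) \<in> P) (r (\<^bold>\<not> g \<psi>) \<in> P)"
    have "is_hom Fm FOUR ?h"
      using is_hom_comp[OF g is_hom_comp[OF reg_parts_hom prime_set_hom[OF P(1)]]] by simp
    moreover have "?h ` \<Gamma> \<subseteq> Tr"
      using sub P(2) by (auto simp: FF_top[OF u])
    ultimately show False
      using ent P(3) unfolding LB_entails_def by fastforce
  qed
qed

text \<open>Identifying regular \<open>p <_k q\<close> would, with the witness \<open>c\<close> of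
  \<open>cond\<close>, identify \<open>u\<close> with \<open>p \<oplus> c\<close>, which lies
  outside the bifilter. Compatible congruences are therefore trivial on regular elements, and
  \<open>pair\<close> rebuilds every element from two of these.\<close>

lemma reduced_FF:
  assumes u: "is_top (Reg A) u"
    and cond: "\<And>a b. a \<in> R \<Longrightarrow> b \<in> R \<Longrightarrow> a \<otimes> b = a \<Longrightarrow> a \<noteq> b \<Longrightarrow>
      \<exists>c\<in>R. a \<oplus> c \<noteq> u \<and> b \<oplus> c = u"
  shows "reduced A (FF A u)"
proof -
  have uR: "u \<in> R" using u by (simp add: is_top_def)
  have "a = b" if \<eta>: "congruence A \<eta>" "compatible \<eta> (FF A u)" and ab: "(a, b) \<in> \<eta>" for \<eta> a b
  proof -
    have eq: "equiv U \<eta>"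
      and cong: "\<And>s a a' b b'. (a, a') \<in> \<eta> \<Longrightarrow> (b, b') \<in> \<eta> \<Longrightarrow> (bop A s a b, bop A s a' b') \<in> \<eta>"
      and congn: "\<And>a a'. (a, a') \<in> \<eta> \<Longrightarrow> (\<^bold>\<not> a, \<^bold>\<not> a') \<in> \<eta>"
      using \<eta>(1) by (auto simp: congruence_def)
    have U: "a \<in> U" "b \<in> U"
      using eq ab by (auto simp: equiv_def)
    have refl: "(a, a) \<in> \<eta>" if "a \<in> U" for a
      using eq that by (auto simp: equiv_def refl_on_def)
    have sym: "(b, a) \<in> \<eta>" if "(a, b) \<in> \<eta>" for a b
      using eq that by (auto simp: equiv_def sym_def)
    have le: "p = q" if pq: "(p, q) \<in> \<eta>" "p \<in> R" "q \<in> R" "p \<otimes> q = p" for p q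
    proof (rule ccontr)
      assume "p \<noteq> q"
      then obtain c where c: "c \<in> R" "p \<oplus> c \<noteq> u" "q \<oplus> c = u"
        using cond pq by blast
      have "(u, p \<oplus> c) \<in> \<eta>"
        using cong[OF sym[OF pq(1)] refl[of c], of Oplus] c by (simp add: in_Reg_iff)
      moreover have "u \<in> FF A u"
        by (simp add: FF_def)
      ultimately have "p \<oplus> c \<in> FF A u"
        using \<eta>(2) unfolding compatible_def by blast
      then show False
        using c pq by (simp add: FF_top[OF u] reg_part_Reg Reg_closed)
    qed
    \<comment> \<open>The meet \<open>p \<otimes> q\<close> is congruent to both elements and below
      both, which reduces the claim to comparable pairs.\<close>
    have "p = q" if pq: "(p, q) \<in> \<eta>" "p \<in> R" "q \<in> R" for p q
    proof -
      have U: "p \<in> U" "q \<in> U" using pq by (auto simp: in_Reg_iff)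
      have "(p \<otimes> q, q) \<in> \<eta>" "(p \<otimes> q, p) \<in> \<eta>"
        using cong[OF pq(1) refl[of q], of Otimes] cong[OF refl[of p] sym[OF pq(1)], of Otimes] U
        by (simp_all add: idem)
      moreover have "p \<otimes> q \<otimes> q = p \<otimes> q" "p \<otimes> q \<otimes> p = p \<otimes> q"
        using U assoc[of p q q Otimes] comm[of p q] assoc[of q p p Otimes] by (simp_all add: idem)
      ultimately show ?thesis
        using le pq Reg_closed by metis
    qed
    moreover have "(r x, r y) \<in> \<eta>" if "(x, y) \<in> \<eta>" for x y
      unfolding reg_part_def Let_def using that by (intro cong congn)
    ultimately have "r a = r b" "r (\<^bold>\<not> a) = r (\<^bold>\<not> b)"
      using U ab congn by simp_all
    then show ?thesis
      using U pair_reg_part by metis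
  qed
  moreover have "congruence A (Id_on U)"
    by (auto simp: congruence_def equiv_def refl_on_def sym_def trans_def)
  moreover have "\<eta> \<subseteq> U \<times> U" if "congruence A \<eta>" for \<eta>
    using that by (auto simp: congruence_def equiv_def)
  ultimately show ?thesis
    unfolding reduced_def is_greatest_compatible_congruence_def
    by (fastforce simp: compatible_def)
qed

end

text \<open>Homomorphisms obtained from prime filters jointly separate the points of the product,
  one coordinate at a time.\<close>

lemma four_variety_if_isomorphic:
  assumes "algebra A" and iso: "isomorphic A (prod_bilattice L)" and D: "is_distrib_lattice L"
  shows "four_variety A"
proof
  fix \<phi> \<psi> g
  assume eq: "\<And>h. is_hom Fm FOUR h \<Longrightarrow> h \<phi> = h \<psi>" and g: "is_hom Fm A g"
  interpret carrier_lattice L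
    using D by unfold_locales (simp add: is_distrib_lattice_def)
  obtain i where i: "is_hom A (prod_bilattice L) i" and inj: "inj_on i (univ A)"
    using iso by (auto simp: isomorphic_def bij_betw_def)
  have gU: "g \<chi> \<in> univ A" for \<chi>
    using g by (simp add: is_hom_def)
  then have iU: "i (g \<chi>) \<in> C \<times> C" for \<chi>
    using i by (simp add: is_hom_def prod_bilattice_def)
  have same: "fst (i (g \<phi>)) \<in> P \<longleftrightarrow> fst (i (g \<psi>)) \<in> P"
    "snd (i (g \<phi>)) \<in> P \<longleftrightarrow> snd (i (g \<psi>)) \<in> P" if "prime_set L P" for P
    using eq[OF is_hom_comp[OF g is_hom_comp[OF i prime_set_hom[OF that]]]]
    by (simp_all add: case_prod_beta) (metis four_of_Tr)+
  have separated: "x = y" if "x \<in> C" "y \<in> C" "\<And>P. prime_set L P \<Longrightarrow> x \<in> P \<longleftrightarrow> y \<in> P" for x y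
    using that prime_filter_separation[OF D] by (metis le_antisym)
  have "i (g \<phi>) = i (g \<psi>)"
    using iU same by (intro prod_eqI separated) (auto simp: mem_Times_iff)
  then show "g \<phi> = g \<psi>"
    using inj gU by (simp add: inj_on_def)
qed (fact assms(1))

section \<open>Reduced models\<close>

text \<open>This form has two useful degenerate cases: equal conjuncts give an equivalence, and
  \<open>\<chi> = \<phi>\<close> gives a one-way consequence.\<close>

lemma LB_model_conj:
  assumes "LB_model A F" "is_hom Fm A g"
    and "\<And>h. is_hom Fm FOUR h \<Longrightarrow> h \<chi> \<in> Tr \<longleftrightarrow> h \<phi> \<in> Tr \<and> h \<psi> \<in> Tr"
  shows "g \<chi> \<in> F \<longleftrightarrow> g \<phi> \<in> F \<and> g \<psi> \<in> F"
proof -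
  have "LB_entails {\<chi>} \<phi>" "LB_entails {\<chi>} \<psi>" "LB_entails {\<phi>, \<psi>} \<chi>"
    using assms(3) by (auto simp: LB_entails_def)
  then show ?thesis
    using assms(1,2) unfolding LB_model_def by (metis (no_types, lifting) empty_subsetI
        image_empty image_insert insert_subset)
qed

lemma LB_model_iff:
  assumes "LB_model A F" "is_hom Fm A g"
    and "\<And>h. is_hom Fm FOUR h \<Longrightarrow> h \<phi> \<in> Tr \<longleftrightarrow> h \<psi> \<in> Tr"
  shows "g \<phi> \<in> F \<longleftrightarrow> g \<psi> \<in> F"
  using LB_model_conj[OF assms(1,2), of \<phi> \<psi> \<psi>] assms(3) by blast

locale LB_reduced =
  fixes A :: "'a alg" and F :: "'a set"
  assumes algebra: "algebra A" and nontrivial: "nontrivial A" and sub: "F \<subseteq> univ A"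
    and model: "LB_model A F" and reduced: "reduced A F"
begin

lemma closed [simp]:
  "a \<in> univ A \<Longrightarrow> b \<in> univ A \<Longrightarrow> bop A s a b \<in> univ A" "a \<in> univ A \<Longrightarrow> neg A a \<in> univ A"
  using algebra by (auto simp: algebra_def)

lemma model_conj3:
  assumes "a \<in> univ A" "b \<in> univ A" "c \<in> univ A"
    and "\<And>h. is_hom Fm FOUR h \<Longrightarrow> h \<chi> \<in> Tr \<longleftrightarrow> h \<phi> \<in> Tr \<and> h \<psi> \<in> Tr"
  shows "ev A (assign a b c) \<chi> \<in> F \<longleftrightarrow>
    ev A (assign a b c) \<phi> \<in> F \<and> ev A (assign a b c) \<psi> \<in> F"
  using assms by (intro LB_model_conj[OF model] ev_assign_hom algebra)

lemma model_iff3: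
  assumes "a \<in> univ A" "b \<in> univ A" "c \<in> univ A"
    and "\<And>h. is_hom Fm FOUR h \<Longrightarrow> h \<phi> \<in> Tr \<longleftrightarrow> h \<psi> \<in> Tr"
  shows "ev A (assign a b c) \<phi> \<in> F \<longleftrightarrow> ev A (assign a b c) \<psi> \<in> F"
  using assms by (intro LB_model_iff[OF model] ev_assign_hom algebra)

lemmas ent_simps = assign_def hom_FOUR_Tr ev_reg_part hom_FOUR_reg_part

definition K :: "'a \<Rightarrow> 'a \<Rightarrow> bool" where
  "K a c \<longleftrightarrow> bop A Or a c \<in> F"

lemma K_conj:
  assumes "a \<in> univ A" "b \<in> univ A" "c \<in> univ A"
  shows "K (bop A And a b) c \<longleftrightarrow> K a c \<and> K b c"
    "K (bop A Otimes a b) c \<longleftrightarrow> K a c \<and> K b c"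
    "K (neg A (bop A Or a b)) c \<longleftrightarrow> K (neg A a) c \<and> K (neg A b) c"
    "K (neg A (bop A Otimes a b)) c \<longleftrightarrow> K (neg A a) c \<and> K (neg A b) c"
  unfolding K_def
  using model_conj3[of a b c "Bin Or (Bin And (Var 0) (Var 1)) (Var 2)"
      "Bin Or (Var 0) (Var 2)" "Bin Or (Var 1) (Var 2)"]
    model_conj3[of a b c "Bin Or (Bin Otimes (Var 0) (Var 1)) (Var 2)"
      "Bin Or (Var 0) (Var 2)" "Bin Or (Var 1) (Var 2)"]
    model_conj3[of a b c "Bin Or (Neg (Bin Or (Var 0) (Var 1))) (Var 2)"
      "Bin Or (Neg (Var 0)) (Var 2)" "Bin Or (Neg (Var 1)) (Var 2)"]
    model_conj3[of a b c "Bin Or (Neg (Bin Otimes (Var 0) (Var 1))) (Var 2)"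
      "Bin Or (Neg (Var 0)) (Var 2)" "Bin Or (Neg (Var 1)) (Var 2)"] assms
  by (auto simp: ent_simps)

lemma K_disj:
  assumes "a \<in> univ A" "b \<in> univ A" "c \<in> univ A"
  shows "K (bop A Or a b) c \<longleftrightarrow> K a (bop A Or b c)"
    "K (bop A Oplus a b) c \<longleftrightarrow> K a (bop A Or b c)"
    "K (neg A (bop A And a b)) c \<longleftrightarrow> K (neg A a) (bop A Or (neg A b) c)"
    "K (neg A (bop A Oplus a b)) c \<longleftrightarrow> K (neg A a) (bop A Or (neg A b) c)"
  unfolding K_def
  using model_iff3[of a b c "Bin Or (Bin Or (Var 0) (Var 1)) (Var 2)"
      "Bin Or (Var 0) (Bin Or (Var 1) (Var 2))"]
    model_iff3[of a b c "Bin Or (Bin Oplus (Var 0) (Var 1)) (Var 2)"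
      "Bin Or (Var 0) (Bin Or (Var 1) (Var 2))"]
    model_iff3[of a b c "Bin Or (Neg (Bin And (Var 0) (Var 1))) (Var 2)"
      "Bin Or (Neg (Var 0)) (Bin Or (Neg (Var 1)) (Var 2))"]
    model_iff3[of a b c "Bin Or (Neg (Bin Oplus (Var 0) (Var 1))) (Var 2)"
      "Bin Or (Neg (Var 0)) (Bin Or (Neg (Var 1)) (Var 2))"] assms
  by (auto simp: ent_simps)

lemma K_left_commute:
  assumes "a \<in> univ A" "b \<in> univ A" "c \<in> univ A"
  shows "K a (bop A Or b c) \<longleftrightarrow> K b (bop A Or a c)"
  unfolding K_def
  using model_iff3[of a b c "Bin Or (Var 0) (Bin Or (Var 1) (Var 2))"
      "Bin Or (Var 1) (Bin Or (Var 0) (Var 2))"] assms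
  by (auto simp: ent_simps)

lemma K_neg_neg: "a \<in> univ A \<Longrightarrow> c \<in> univ A \<Longrightarrow> K (neg A (neg A a)) c \<longleftrightarrow> K a c"
  unfolding K_def
  using model_iff3[of a c c "Bin Or (Neg (Neg (Var 0))) (Var 1)" "Bin Or (Var 0) (Var 1)"]
  by (auto simp: ent_simps)

lemma K_self: "a \<in> univ A \<Longrightarrow> K a a \<longleftrightarrow> a \<in> F"
  unfolding K_def
  using model_iff3[of a a a "Bin Or (Var 0) (Var 0)" "Var 0"] by (auto simp: ent_simps)

lemma K_commute: "a \<in> univ A \<Longrightarrow> b \<in> univ A \<Longrightarrow> K a b \<longleftrightarrow> K b a"
  unfolding K_def
  using model_iff3[of a b b "Bin Or (Var 0) (Var 1)" "Bin Or (Var 1) (Var 0)"]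
  by (auto simp: ent_simps)

text \<open>The arguments are replaced one at a time, with \<open>K_left_commute\<close> bringing
  the one to be replaced to the front.\<close>

lemma K_disj_cong:
  assumes "a \<in> univ A" "a' \<in> univ A" "b \<in> univ A" "b' \<in> univ A" "c \<in> univ A"
    and "\<forall>c\<in>univ A. K a c \<longleftrightarrow> K a' c" "\<forall>c\<in>univ A. K b c \<longleftrightarrow> K b' c"
  shows "K a (bop A Or b c) \<longleftrightarrow> K a' (bop A Or b' c)"
  using assms K_left_commute by (metis closed(1))

text \<open>The two clauses are the contextual versions of the two bits in
  \<open>four_eq_iff\<close>.\<close>

definition \<theta> :: "('a \<times> 'a) set" where
  "\<theta> = {(a, b) \<in> univ A \<times> univ A.
     (\<forall>c\<in>univ A. K a c \<longleftrightarrow> K b c) \<and> (\<forall>c\<in>univ A. K (neg A a) c \<longleftrightarrow> K (neg A b) c)}"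

lemma congruence_\<theta>: "congruence A \<theta>"
proof -
  have "(bop A s a b, bop A s a' b') \<in> \<theta>" if "(a, a') \<in> \<theta>" "(b, b') \<in> \<theta>" for s a a' b b'
  proof -
    have U: "a \<in> univ A" "a' \<in> univ A" "b \<in> univ A" "b' \<in> univ A"
      and K: "\<forall>c\<in>univ A. K a c \<longleftrightarrow> K a' c" "\<forall>c\<in>univ A. K b c \<longleftrightarrow> K b' c"
      "\<forall>c\<in>univ A. K (neg A a) c \<longleftrightarrow> K (neg A a') c" "\<forall>c\<in>univ A. K (neg A b) c \<longleftrightarrow> K (neg A b') c"
      using that by (auto simp: \<theta>_def)
    have "\<forall>c\<in>univ A. K a (bop A Or b c) \<longleftrightarrow> K a' (bop A Or b' c)"
      using U by (intro ballI K_disj_cong[OF _ _ _ _ _ K(1,2)])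
    moreover have "\<forall>c\<in>univ A.
        K (neg A a) (bop A Or (neg A b) c) \<longleftrightarrow> K (neg A a') (bop A Or (neg A b') c)"
      using U by (intro ballI K_disj_cong[OF _ _ _ _ _ K(3,4)] closed)
    ultimately show ?thesis
      using U K by (cases s) (simp_all add: \<theta>_def K_conj K_disj)
  qed
  moreover have "(neg A a, neg A b) \<in> \<theta>" if "(a, b) \<in> \<theta>" for a b
    using that by (auto simp: \<theta>_def K_neg_neg)
  moreover have "equiv (univ A) \<theta>"
    by (auto simp: equiv_def refl_on_def sym_def trans_def \<theta>_def)
  ultimately show ?thesis
    by (simp add: congruence_def)
qed

lemma \<theta>_eq:
  assumes "(a, b) \<in> \<theta>"
  shows "a = b"
proof -
  \<comment> \<open>Membership of \<open>a\<close> in \<open>F\<close> is \<open>K a a\<close>;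
    replacing \<open>a\<close> by \<open>b\<close> in the first slot, commuting and replacing again
    gives \<open>K b b\<close>.\<close>
  have "compatible \<theta> F"
    unfolding compatible_def \<theta>_def using K_self K_commute by blast
  then have "\<theta> \<subseteq> Id_on (univ A)"
    using reduced congruence_\<theta> by (simp add: reduced_def is_greatest_compatible_congruence_def)
  then show ?thesis
    using assms by blast
qed

end

text \<open>An identity \<open>\<phi> \<approx> \<psi>\<close> of the four-element bilattice yields interderivable formulas
  \<open>\<phi> \<or> x\<close> and \<open>\<psi> \<or> x\<close> for a variable \<open>x\<close> that is fresh after shifting the variables.\<close>

primrec shift :: "fm \<Rightarrow> fm" where
  "shift (Var n) = Var (Suc n)"
| "shift (Bin s \<phi> \<psi>) = Bin s (shift \<phi>) (shift \<psi>)"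
| "shift (Neg \<phi>) = Neg (shift \<phi>)"

lemma shift_hom: "is_hom Fm Fm shift"
  by (simp add: is_hom_def)

lemma ev_shift: "ev A (case_nat c v) (shift \<phi>) = ev A v \<phi>"
  by (induction \<phi>) simp_all

sublocale LB_reduced \<subseteq> four_variety A
proof
  fix \<phi> \<psi> g
  assume eq: "\<And>h. is_hom Fm FOUR h \<Longrightarrow> h \<phi> = h \<psi>" and g: "is_hom Fm A g"
  let ?v = "\<lambda>n. g (Var n)"
  have gU: "g \<chi> \<in> univ A" for \<chi>
    using g by (simp add: is_hom_def)
  have "K (g \<phi>) c \<longleftrightarrow> K (g \<psi>) c" "K (neg A (g \<phi>)) c \<longleftrightarrow> K (neg A (g \<psi>)) c" if c: "c \<in> univ A" for c
  proof -
    \<comment> \<open>Variable 0 takes the context \<open>c\<close>, while each shifted variable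
      keeps the value that \<open>g\<close> gave to the original.\<close>
    have hom: "is_hom Fm A (ev A (case_nat c ?v))"
      using c gU by (intro ev_hom algebra) (simp split: nat.split)
    have eq': "h (shift \<phi>) = h (shift \<psi>)" if "is_hom Fm FOUR h" for h
      using eq[OF is_hom_comp[OF shift_hom that]] .
    show "K (g \<phi>) c \<longleftrightarrow> K (g \<psi>) c"
      using LB_model_iff[OF model hom, of "Bin Or (shift \<phi>) (Var 0)" "Bin Or (shift \<psi>) (Var 0)"]
      by (simp add: hom_FOUR eq' ev_shift K_def flip: hom_eq_ev[OF g])
    show "K (neg A (g \<phi>)) c \<longleftrightarrow> K (neg A (g \<psi>)) c"
      using LB_model_iff[OF model hom, of "Bin Or (Neg (shift \<phi>)) (Var 0)"
          "Bin Or (Neg (shift \<psi>)) (Var 0)"]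
      by (simp add: hom_FOUR eq' ev_shift K_def flip: hom_eq_ev[OF g])
  qed
  then show "g \<phi> = g \<psi>"
    using gU by (intro \<theta>_eq) (simp add: \<theta>_def)
qed (fact algebra)

section \<open>The designated set of a reduced model\<close>

context LB_reduced
begin

text \<open>The logic has no theorems, since all variables may be sent to \<open>Bt\<close>.
  Non-emptiness comes from reducedness: for empty \<open>F\<close> the full relation would be
  compatible.\<close>

lemma F_nonempty: "F \<noteq> {}"
proof
  assume "F = {}"
  then have "compatible (univ A \<times> univ A) F"
    by (simp add: compatible_def)
  moreover have "congruence A (univ A \<times> univ A)"
    by (auto simp: congruence_def equiv_def refl_on_def sym_def trans_def)
  ultimately have "univ A \<times> univ A \<subseteq> Id_on (univ A)"
    using reduced by (simp add: reduced_def is_greatest_compatible_congruence_def)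
  then show False
    using nontrivial by (auto simp: nontrivial_def)
qed

lemma reg_part_F: "a \<in> U \<Longrightarrow> r a \<in> F \<longleftrightarrow> a \<in> F"
  using model_iff3[of a a a "reg_part Fm (Var 0)" "Var 0"] by (auto simp: ent_simps)

lemma F_oplus: "a \<in> F \<Longrightarrow> b \<in> U \<Longrightarrow> a \<oplus> b \<in> F"
  using model_conj3[of a b b "Var 0" "Var 0" "Bin Oplus (Var 0) (Var 1)"] sub
  by (auto simp: ent_simps)

text \<open>Designation in \<open>FOUR\<close> treats \<open>Or\<close> and \<open>Oplus\<close>
  alike and is invariant under \<open>r\<close>, so regular contexts suffice.\<close>

lemma K_reg: "p \<in> R \<Longrightarrow> c \<in> U \<Longrightarrow> K p c \<longleftrightarrow> p \<oplus> r c \<in> F"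
  unfolding K_def
  using model_iff3[of p c c "Bin Or (Var 0) (Var 1)" "Bin Oplus (Var 0) (reg_part Fm (Var 1))"]
  by (auto simp: ent_simps in_Reg_iff)

text \<open>Negation fixes \<open>p\<close> and \<open>q\<close>, so the two clauses of
  \<open>\<theta>\<close> coincide, and \<open>K_reg\<close> restricts the contexts to regular
  ones.\<close>

lemma regular_eq:
  assumes "p \<in> R" "q \<in> R" "\<And>c. c \<in> R \<Longrightarrow> p \<oplus> c \<in> F \<longleftrightarrow> q \<oplus> c \<in> F"
  shows "p = q"
  using assms by (intro \<theta>_eq) (auto simp: \<theta>_def in_Reg_iff[of p] in_Reg_iff[of q] K_reg)

text \<open>The top is the regular part of any designated element. Two regular elements of
  \<open>F\<close> are equal because each stays in \<open>F\<close> when anything is added by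
  \<open>Oplus\<close>, so no context tells them apart.\<close>

lemma top_and_filter:
  obtains u where "is_top (Reg A) u" "\<And>p. p \<in> R \<Longrightarrow> p \<in> F \<longleftrightarrow> p = u" "F = FF A u"
proof -
  obtain a where a: "a \<in> F" "a \<in> U"
    using F_nonempty sub by blast
  have uR: "r a \<in> R" and uF: "r a \<in> F"
    using a by (simp_all add: reg_part_F)
  have uniq: "p = r a" if "p \<in> R" "p \<in> F" for p
    using that uR uF by (intro regular_eq) (auto intro: F_oplus simp: in_Reg_iff)
  have "p \<otimes> r a = p" if p: "p \<in> R" for p
  proof -
    have "p \<oplus> r a \<in> F"
      using F_oplus[OF uF, of p] comm[of "r a" p Oplus] p a by (simp add: in_Reg_iff)
    then have "p \<oplus> r a = r a"
      by (rule uniq[OF Reg_closed(2)[OF p uR]])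
    then show ?thesis
      using absorb(3)[of p "r a"] p a by (simp add: in_Reg_iff)
  qed
  then have top: "is_top (Reg A) (r a)"
    using uR by (simp add: is_top_def lat_le_def)
  have "F = {b \<in> U. r b = r a}"
  proof (intro set_eqI iffI)
    fix b
    show "b \<in> {b \<in> U. r b = r a}" if "b \<in> F"
      using that sub reg_part_F[of b] uniq[of "r b"] by auto
    show "b \<in> F" if "b \<in> {b \<in> U. r b = r a}"
      using that uF reg_part_F[of b] by auto
  qed
  then show ?thesis
    using that[OF top] uniq uF FF_top[OF top] by metis
qed

end

theorem theorem3p4p17:
  fixes A :: "'a alg" and F :: "'a set"
  assumes "algebra A" and "nontrivial A" and "F \<subseteq> univ A"
  shows "LB_model A F \<and> reduced A F \<longleftrightarrow>
    distrib_bilattice A \<and>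
    isomorphic A (prod_bilattice (Reg A)) \<and>
    (\<exists>u.
      (is_distrib_lattice (Reg A) \<and> is_top (Reg A) u \<and>
       (\<forall>a\<in>lat_univ (Reg A). \<forall>b\<in>lat_univ (Reg A). lat_less (k_reduct A) a b \<longrightarrow>
          (\<exists>c\<in>lat_univ (Reg A). bop A Oplus a c \<noteq> u \<and> bop A Oplus b c = u))) \<and>
      F = FF A u)"
    (is "?model \<longleftrightarrow> ?structure")
proof
  assume ?model
  then interpret LB_reduced A F
    using assms by unfold_locales auto
  obtain u where u: "is_top (Reg A) u" and Fu: "\<And>p. p \<in> R \<Longrightarrow> p \<in> F \<longleftrightarrow> p = u" and F: "F = FF A u"
    by (rule top_and_filter) blast
  have "\<exists>c\<in>R. a \<oplus> c \<noteq> u \<and> b \<oplus> c = u" if ab: "a \<in> R" "b \<in> R" "lat_less (k_reduct A) a b" for a b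
  proof -
    have U: "a \<in> U" "b \<in> U" and "a \<noteq> b" "a \<otimes> b = a"
      using ab by (auto simp: in_Reg_iff lat_less_def lat_le_def k_reduct_def)
    then obtain c where c: "c \<in> R" "a \<oplus> c \<in> F \<longleftrightarrow> b \<oplus> c \<notin> F"
      using regular_eq ab by blast
    then have cU: "c \<in> U" by (simp add: in_Reg_iff)
    \<comment> \<open>The context \<open>c\<close> separates \<open>a\<close> from \<open>b\<close>
      in an unknown direction. As \<open>b\<close> absorbs \<open>a\<close> and \<open>F\<close> is
      closed under adding elements, only \<open>b \<oplus> c\<close> can be the designated
      one.\<close>
    have "b \<oplus> a = b"
      using U \<open>a \<otimes> b = a\<close> absorb(4)[of b a] comm[of a b Otimes] by simp
    then have "b \<oplus> c = a \<oplus> c \<oplus> b"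
      using U cU by (metis assoc comm closed(1))
    then have "b \<oplus> c \<in> F" if "a \<oplus> c \<in> F"
      using F_oplus[OF that U(2)] by simp
    then show ?thesis
      using c ab Fu Reg_closed(2) by metis
  qed
  then show ?structure
    using bilattice isomorphic_Reg distrib_lattice_Reg u F by blast
next
  assume ?structure
  then obtain u where iso: "isomorphic A (prod_bilattice (Reg A))"
    and D: "is_distrib_lattice (Reg A)" and u: "is_top (Reg A) u" and F: "F = FF A u"
    and cond: "\<And>a b. a \<in> lat_univ (Reg A) \<Longrightarrow> b \<in> lat_univ (Reg A) \<Longrightarrow> lat_less (k_reduct A) a b \<Longrightarrow>
      \<exists>c\<in>lat_univ (Reg A). bop A Oplus a c \<noteq> u \<and> bop A Oplus b c = u"
    by blast
  \<comment> \<open>The product representation over the distributive lattice \<open>Reg A\<close>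
    yields all identities of \<open>FOUR\<close>.\<close>
  interpret four_variety A
    using assms(1) iso D by (rule four_variety_if_isomorphic)
  show ?model
    unfolding F using u cond
    by (intro conjI LB_model_FF reduced_FF) (auto simp: lat_less_def lat_le_def k_reduct_def)
qed

end
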